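(* Let $\mathcal{R}$ be a finite triangle-free induced subgraph of the triangular lattice. Then $\mathcal{R}$ is $(a,b)$-choosable for all positive integers $a,b$ with $\tfrac{a}{b}\ge\tfrac52$ (in particular, $\mathcal{R}$ is $(5,2)$-choosable).
   Context: The triangular lattice has vertex set $\mathbb{Z}^2$, with $(x,y)$ adjacent to $(x\pm1,y)$, $(x-1,y+1)$, $(x,y+1)$, $(x,y-1)$, $(x+1,y-1)$. A graph $G$ is $(a,b)$-choosable if for every assignment $L$ of a set $L(v)\subset\mathbb{N}$ with $|L(v)|=a$ to each vertex $v$, there are sets $c(v)\subset L(v)$ with $|c(v)|=b$ and $c(v)\cap c(v')=\emptyset$ for every edge $vv'$. *)

theory Defs
  imports Complex_Main "Graph_Theory.Graph_Theory"
begin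

text \<open>
  Simple undirected graphs are represented, as in \<open>Graph_Theory\<close>, by symmetric loop-free
  digraphs: an edge is a pair of opposite arcs.
\<close>

definition triangular_lattice :: "(int \<times> int) pair_pre_digraph" where
  "triangular_lattice =
     \<lparr> pverts = UNIV,
       parcs = {((x, y), w) | x y w.
         w \<in> {(x + 1, y), (x - 1, y), (x - 1, y + 1), (x, y + 1), (x, y - 1), (x + 1, y - 1)}} \<rparr>"

definition triangle_free :: "('v, 'e) pre_digraph \<Rightarrow> bool" where
  "triangle_free G \<longleftrightarrow>
     (\<nexists>u v w. distinct [u, v, w] \<and> u \<rightarrow>\<^bsub>G\<^esub> v \<and> v \<rightarrow>\<^bsub>G\<^esub> w \<and> w \<rightarrow>\<^bsub>G\<^esub> u)"

text \<open>
  The explicit finiteness of \<open>L v\<close> excludes infinite lists when \<open>a = 0\<close>, as \<open>card\<close> is 0 on infinite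
  sets. The sets \<open>c v\<close> are then finite because they are subsets of \<open>L v\<close>.
\<close>

definition choosable :: "('v, 'e) pre_digraph \<Rightarrow> nat \<Rightarrow> nat \<Rightarrow> bool" where
  "choosable G a b \<longleftrightarrow>
     (\<forall>L :: 'v \<Rightarrow> nat set. (\<forall>v\<in>verts G. finite (L v) \<and> card (L v) = a) \<longrightarrow>
       (\<exists>c :: 'v \<Rightarrow> nat set. (\<forall>v\<in>verts G. c v \<subseteq> L v \<and> card (c v) = b) \<and>
         (\<forall>v v'. v \<rightarrow>\<^bsub>G\<^esub> v' \<longrightarrow> c v \<inter> c v' = {})))"

lemma pverts_triangular_lattice [simp]: "pverts triangular_lattice = UNIV"
  by (simp add: triangular_lattice_def)

lemma parcs_triangular_lattice_iff:
  "((x, y), (x', y')) \<in> parcs triangular_lattice \<longleftrightarrow>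
     (x', y') \<in> {(x + 1, y), (x - 1, y), (x - 1, y + 1), (x, y + 1), (x, y - 1), (x + 1, y - 1)}"
  by (simp add: triangular_lattice_def)

lemma pair_bidirected_digraph_triangular_lattice:
  "pair_bidirected_digraph triangular_lattice"
proof unfold_locales
  show "symmetric (with_proj triangular_lattice)"
    unfolding symmetric_def with_proj_simps
  proof (rule symI)
    fix v w :: "int \<times> int"
    assume "(v, w) \<in> parcs triangular_lattice"
    then show "(w, v) \<in> parcs triangular_lattice"
      by (cases v; cases w) (auto simp: parcs_triangular_lattice_iff)
  qed
next
  fix e assume "e \<in> parcs triangular_lattice"
  then show "fst e \<noteq> snd e"
    by (cases e; cases "fst e"; cases "snd e") (auto simp: parcs_triangular_lattice_iff)
qed simp_all

lemma induced_subgraph_triangular_lattice_iff: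
  "induced_subgraph (with_proj R) (with_proj triangular_lattice) \<longleftrightarrow>
     parcs R = parcs triangular_lattice \<inter> (pverts R \<times> pverts R)"
proof -
  have restrict: "{e \<in> parcs triangular_lattice. fst e \<in> pverts R \<and> snd e \<in> pverts R} =
      parcs triangular_lattice \<inter> (pverts R \<times> pverts R)"
    by (auto simp: mem_Times_iff)
  have "wf_digraph (with_proj triangular_lattice)"
    by (simp add: wf_digraph_def)
  moreover have "wf_digraph (with_proj R)"
    if "parcs R = parcs triangular_lattice \<inter> (pverts R \<times> pverts R)"
    unfolding wf_digraph_def with_proj_simps using that by (metis IntD2 mem_Times_iff)
  moreover have "parcs R \<subseteq> parcs triangular_lattice"
    if "parcs R = parcs triangular_lattice \<inter> (pverts R \<times> pverts R)"
    using that by blast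
  ultimately show ?thesis
    unfolding induced_subgraph_def subgraph_def compatible_def with_proj_simps restrict
      pverts_triangular_lattice
    by (metis subset_UNIV)
qed

end

theory Submission
  imports Defs "HOL-Library.Product_Plus"
begin

text \<open>
  Induction on the vertex set, peeling it off along the linear functional \<open>x + 2y\<close>. Let \<open>M\<close> be its
  maximum, \<open>T\<close> the set of vertices of level \<open>M\<close> and \<open>W\<close> their neighbours of level \<open>M - 1\<close>. Then
  \<open>T \<union> W\<close> induces a union of zigzag paths alternating between \<open>T\<close> and \<open>W\<close>; by triangle-freeness,
  a vertex of \<open>W\<close> has at most one neighbour outside \<open>T \<union> W\<close>, and a vertex of \<open>T\<close> with two
  neighbours has both of them in \<open>W\<close>. Once everything else is coloured, the vertices of \<open>W\<close> keep
  at least \<open>a - b\<close> colours. If \<open>v \<in> T\<close> has two neighbours in \<open>W\<close>, then by counting one can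
  prescribe at most \<open>b/2\<close> colours for each of them, either common to both or outside \<open>L v\<close>,
  so that \<open>v\<close> keeps \<open>b\<close> colours. A vertex of \<open>W\<close> receives at most two such prescriptions, hence
  can satisfy both.
\<close>

text \<open>Two disjoint \<open>b\<close>-sets inside \<open>L\<close> leave only
  \<open>a - 2 * b\<close> colours, so \<open>s = 3 * b - a\<close> colours must be saved. Each
  prescribed colour outside \<open>L\<close>, and each colour of \<open>L\<close> prescribed on both
  sides, saves one. Since \<open>A \<inter> L\<close> and \<open>B \<inter> L\<close> both lie in
  \<open>L\<close>, at least \<open>2 * (a - b) - a = a - 2 * b\<close> savings are available, and
  \<open>5 * b \<le> 2 * a\<close> gives both \<open>s \<le> a - 2 * b\<close> and
  \<open>s \<le> b div 2\<close>.\<close>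

lemma ex_small_sets_forcing_overlap:
  fixes a b :: nat
  assumes L: "finite L" "card L = a"
    and A: "finite A" "a - b \<le> card A" and B: "finite B" "a - b \<le> card B"
    and ab: "5 * b \<le> 2 * a"
  obtains X Y where "X \<subseteq> A" "Y \<subseteq> B" "card X \<le> b div 2" "card Y \<le> b div 2"
    "\<And>c d. X \<subseteq> c \<Longrightarrow> Y \<subseteq> d \<Longrightarrow> finite c \<Longrightarrow> finite d \<Longrightarrow> card c = b \<Longrightarrow> card d = b \<Longrightarrow>
       b \<le> card (L - (c \<union> d))"
proof -
  define s where "s = 3 * b - a"
  have cA: "card A = card (A - L) + card (A \<inter> L)"
    using A(1) by (metis add.commute card_Int_Diff)
  have cB: "card B = card (B - L) + card (B \<inter> L)"
    using B(1) by (metis add.commute card_Int_Diff)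
  have "card (A \<inter> L) + card (B \<inter> L) = card ((A \<inter> L) \<union> (B \<inter> L)) + card ((A \<inter> L) \<inter> (B \<inter> L))"
    using A B by (intro card_Un_Int) auto
  also have "card ((A \<inter> L) \<union> (B \<inter> L)) \<le> a"
    using L by (metis Un_least card_mono inf_le2)
  also have "(A \<inter> L) \<inter> (B \<inter> L) = A \<inter> B \<inter> L" by blast
  finally have le: "s \<le> card (A - L) + card (B - L) + card (A \<inter> B \<inter> L)"
    using cA cB A(2) B(2) ab by (simp add: s_def)
  \<comment> \<open>Split the savings greedily: colours of \<open>A\<close> outside \<open>L\<close>
    first, then those of \<open>B\<close>, then common colours.\<close>
  obtain i j k where ijk: "i \<le> card (A - L)" "j \<le> card (B - L)" "k \<le> card (A \<inter> B \<inter> L)"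
    "i + j + k = s"
  proof
    let ?i = "min s (card (A - L))" let ?j = "min (s - ?i) (card (B - L))"
    show "?i \<le> card (A - L)" "?j \<le> card (B - L)" "s - ?i - ?j \<le> card (A \<inter> B \<inter> L)"
      "?i + ?j + (s - ?i - ?j) = s"
      using le by auto
  qed
  obtain I where I: "I \<subseteq> A - L" "card I = i" "finite I"
    using ijk(1) by (rule obtain_subset_with_card_n)
  obtain J where J: "J \<subseteq> B - L" "card J = j" "finite J"
    using ijk(2) by (rule obtain_subset_with_card_n)
  obtain K where K: "K \<subseteq> A \<inter> B \<inter> L" "card K = k" "finite K"
    using ijk(3) by (rule obtain_subset_with_card_n)
  have s: "s \<le> b div 2" using ab by (simp add: s_def)
  show thesis
  proof
    show "I \<union> K \<subseteq> A" "J \<union> K \<subseteq> B" using I J K by auto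
    show "card (I \<union> K) \<le> b div 2" "card (J \<union> K) \<le> b div 2"
      using card_Un_le[of I K] card_Un_le[of J K] I J K ijk s by auto
  next
    fix c d :: "'a set"
    assume c: "I \<union> K \<subseteq> c" "finite c" "card c = b" and d: "J \<union> K \<subseteq> d" "finite d" "card d = b"
    \<comment> \<open>As \<open>I\<close> and \<open>J\<close> miss \<open>L\<close>, the sets
      \<open>c\<close> and \<open>d\<close> meet \<open>L\<close> in at most \<open>b - i\<close>
      and \<open>b - j\<close> colours; \<open>K\<close> is counted in both, so their union takes at
      most \<open>2 * b - s\<close> colours of \<open>L\<close>.\<close>
    have "card ((c \<inter> L) \<union> I) \<le> b" using c by (metis card_mono Un_subset_iff inf_le1)
    moreover have "card ((c \<inter> L) \<union> I) = card (c \<inter> L) + i"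
      using I c by (subst card_Un_disjoint) auto
    moreover have "card ((d \<inter> L) \<union> J) \<le> b" using d by (metis card_mono Un_subset_iff inf_le1)
    moreover have "card ((d \<inter> L) \<union> J) = card (d \<inter> L) + j"
      using J d by (subst card_Un_disjoint) auto
    moreover have "card (c \<inter> L) + card (d \<inter> L)
        = card ((c \<inter> L) \<union> (d \<inter> L)) + card ((c \<inter> L) \<inter> (d \<inter> L))"
      using c d by (intro card_Un_Int) auto
    moreover have "k \<le> card ((c \<inter> L) \<inter> (d \<inter> L))"
      using K c d by (metis Int_greatest card_mono finite_Int le_sup_iff le_infE)
    moreover have "card ((c \<inter> L) \<union> (d \<inter> L)) = card (L \<inter> (c \<union> d))"
      by (rule arg_cong[where f = card]) blast
    moreover have "card L = card (L \<inter> (c \<union> d)) + card (L - (c \<union> d))"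
      using L(1) by (rule card_Int_Diff)
    ultimately show "b \<le> card (L - (c \<union> d))"
      using ijk(4) L(2) ab s_def by linarith
  qed
qed

abbreviation adjacent :: "int \<times> int \<Rightarrow> int \<times> int \<Rightarrow> bool" where
  "adjacent p q \<equiv> (p, q) \<in> parcs triangular_lattice"

lemma adjacent_iff:
  "adjacent p q \<longleftrightarrow> q - p \<in> {(1, 0), (-1, 0), (-1, 1), (0, 1), (0, -1), (1, -1)}"
  by (cases p; cases q) (auto simp: parcs_triangular_lattice_iff)

lemma adjacent_sym: "adjacent p q \<Longrightarrow> adjacent q p"
  by (cases p; cases q) (auto simp: parcs_triangular_lattice_iff)

text \<open>With axes at 60 degrees, this is twice the projection to the edge direction
  \<open>(0, 1)\<close>. Levels are independent sets, and each vertex has two neighbours one level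
  down and one neighbour two levels down.\<close>

definition level :: "int \<times> int \<Rightarrow> int" where
  "level p = fst p + 2 * snd p"

lemma level_adjacent_neq: "adjacent p q \<Longrightarrow> level p \<noteq> level q"
  by (cases p; cases q) (auto simp: parcs_triangular_lattice_iff level_def)

lemma adjacent_not_above:
  assumes "adjacent p q" "level q \<le> level p"
  obtains "q = p + (-1, 0)" | "q = p + (1, -1)" | "q = p + (0, -1)"
  using assms by (cases p; cases q) (auto simp: parcs_triangular_lattice_iff level_def)

text \<open>A single coloured neighbour costs at most \<open>b\<close> colours. This serves both the
  vertices of \<open>W\<close> and the vertices of \<open>T\<close> with at most one
  neighbour.\<close>

lemma card_Diff_UN_subsingleton:
  assumes "finite A" "card A = a" "N \<subseteq> {x}" "\<And>u. u \<in> N \<Longrightarrow> card (c u) = (b::nat)"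
    "\<And>u. u \<in> N \<Longrightarrow> finite (c u)"
  shows "a - b \<le> card (A - (\<Union>u\<in>N. c u))"
proof (cases "N = {}")
  case False
  then have "N = {x}" using assms(3) by blast
  then show ?thesis using assms diff_card_le_card_Diff[of "c x" A] by auto
qed (use assms in simp)

text \<open>Phrased for vertex sets because the hypotheses on triangles and lists pass to subsets,
  as the induction requires.\<close>

lemma triangle_free_set_choosable:
  fixes V :: "(int \<times> int) set" and L :: "int \<times> int \<Rightarrow> nat set"
  assumes "finite V"
    and "\<And>u v w. \<lbrakk>u \<in> V; v \<in> V; w \<in> V; adjacent u v; adjacent v w\<rbrakk> \<Longrightarrow> \<not> adjacent w u"
    and ab: "5 * b \<le> 2 * a"
    and "\<And>v. v \<in> V \<Longrightarrow> finite (L v) \<and> card (L v) = a"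
  shows "\<exists>c. (\<forall>v\<in>V. c v \<subseteq> L v \<and> card (c v) = b) \<and>
             (\<forall>v\<in>V. \<forall>w\<in>V. adjacent v w \<longrightarrow> c v \<inter> c w = {})"
  using assms(1,2,4)
proof (induction V rule: finite_psubset_induct)
  case (psubset V)
  note tri = psubset.prems(1) and L = psubset.prems(2)
  show ?case
  proof (cases "V = {}")
    case False
    define M where "M = Max (level ` V)"
    define T where "T = {v \<in> V. level v = M}"
    \<comment> \<open>Neighbours of \<open>T\<close> at level \<open>M - 2\<close> stay in
      \<open>V'\<close> and are coloured by induction.\<close>
    define W where "W = {w \<in> V. level w = M - 1 \<and> (\<exists>v\<in>T. adjacent v w)}"
    define V' where "V' = V - (T \<union> W)"
    have le_M: "level v \<le> M" if "v \<in> V" for v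
      using that psubset.hyps by (simp add: M_def)
    have "M \<in> level ` V"
      unfolding M_def using psubset.hyps False by (intro Max_in) auto
    then have "T \<noteq> {}" by (auto simp: T_def)
    then have "V' \<subset> V" by (auto simp: V'_def T_def)
    moreover have "\<not> adjacent w u"
      if "u \<in> V'" "v \<in> V'" "w \<in> V'" "adjacent u v" "adjacent v w" for u v w
      using tri[of u v w] that by (simp add: V'_def)
    moreover have "finite (L v) \<and> card (L v) = a" if "v \<in> V'" for v
      using L[of v] that by (simp add: V'_def)
    ultimately have "\<exists>c. (\<forall>v\<in>V'. c v \<subseteq> L v \<and> card (c v) = b) \<and>
        (\<forall>v\<in>V'. \<forall>w\<in>V'. adjacent v w \<longrightarrow> c v \<inter> c w = {})"
      by (rule psubset.IH)
    then obtain c0 where c0: "\<And>v. v \<in> V' \<Longrightarrow> c0 v \<subseteq> L v \<and> card (c0 v) = b"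
      and c0_disj: "\<And>v w. \<lbrakk>v \<in> V'; w \<in> V'; adjacent v w\<rbrakk> \<Longrightarrow> c0 v \<inter> c0 w = {}"
      by metis
    have fin_c0: "finite (c0 v)" if "v \<in> V'" for v
    proof -
      have "finite (L v)" using L[of v] that by (simp add: V'_def)
      then show ?thesis using c0[OF that] by (meson finite_subset)
    qed

    define N where "N w = {u \<in> V'. adjacent w u}" for w
    define L' where "L' w = L w - (\<Union>u\<in>N w. c0 u)" for w
    have L'_card: "a - b \<le> card (L' w)" and L'_fin: "finite (L' w)" if w: "w \<in> W" for w
    proof -
      obtain v where v: "v \<in> V" "level v = M" "adjacent v w" and wV: "w \<in> V" "level w = M - 1"
        using w by (auto simp: W_def T_def)
      have below: "level u \<le> level w" if "u \<in> N w" for u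
        using that le_M[of u] wV by (force simp: N_def V'_def T_def)
      \<comment> \<open>Of the three lower neighbours of \<open>w\<close>, the one at
        \<open>w + (0, -1)\<close> is adjacent to both others, so two that form no triangle with
        \<open>w\<close> are \<open>w + (-1, 0)\<close> and \<open>w + (1, -1)\<close>. One of these
        is adjacent to \<open>v\<close>, which closes a triangle with \<open>w\<close>.\<close>
      have "u = u'" if u: "u \<in> N w" "u' \<in> N w" for u u'
      proof (rule ccontr)
        assume ne: "u \<noteq> u'"
        have uV: "u \<in> V" "u' \<in> V" "adjacent w u" "adjacent w u'"
          using u by (auto simp: N_def V'_def)
        have "\<not> adjacent u u'" "\<not> adjacent u v" "\<not> adjacent u' v"
          using tri[of w u u'] tri[of w u v] tri[of w u' v] uV v wV adjacent_sym by blast+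
        moreover have "w = v + (-1, 0) \<or> w = v + (1, -1)"
          using v wV(2) by (cases v; cases w) (auto simp: parcs_triangular_lattice_iff level_def)
        moreover have "u \<in> {w + (-1, 0), w + (1, -1), w + (0, -1)}"
          using adjacent_not_above[OF uV(3) below[OF u(1)]] by blast
        moreover have "u' \<in> {w + (-1, 0), w + (1, -1), w + (0, -1)}"
          using adjacent_not_above[OF uV(4) below[OF u(2)]] by blast
        ultimately show False
          using ne adjacent_sym[of u' u] by (auto simp: adjacent_iff algebra_simps zero_prod_def)
      qed
      then obtain x where "N w \<subseteq> {x}" by blast
      then show "a - b \<le> card (L' w)"
        unfolding L'_def using L[OF wV(1)] c0 fin_c0
        by (intro card_Diff_UN_subsingleton) (auto simp: N_def)
      show "finite (L' w)" using L[OF wV(1)] by (simp add: L'_def)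
    qed

    \<comment> \<open>\<open>X\<close> and \<open>Y\<close> are the prescriptions of
      \<open>v\<close> for its two neighbours one level down. They are empty unless \<open>v\<close>
      is in \<open>T\<close> with both neighbours in \<open>W\<close>, so later steps need no case
      distinction on \<open>v\<close>.\<close>
    have "\<exists>X Y. card X \<le> b div 2 \<and> card Y \<le> b div 2 \<and>
        (v + (-1, 0) \<in> W \<longrightarrow> X \<subseteq> L' (v + (-1, 0))) \<and> (v + (1, -1) \<in> W \<longrightarrow> Y \<subseteq> L' (v + (1, -1))) \<and>
        (v \<in> T \<and> v + (-1, 0) \<in> W \<and> v + (1, -1) \<in> W \<longrightarrow>
          (\<forall>c d. X \<subseteq> c \<and> Y \<subseteq> d \<and> finite c \<and> finite d \<and> card c = b \<and> card d = b \<longrightarrow>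
            b \<le> card (L v - (c \<union> d))))" for v
    proof (cases "v \<in> T \<and> v + (-1, 0) \<in> W \<and> v + (1, -1) \<in> W")
      case True
      then have "finite (L v)" "card (L v) = a" using L by (auto simp: T_def)
      then obtain X Y where "X \<subseteq> L' (v + (-1, 0))" "Y \<subseteq> L' (v + (1, -1))"
        "card X \<le> b div 2" "card Y \<le> b div 2"
        "\<And>c d. X \<subseteq> c \<Longrightarrow> Y \<subseteq> d \<Longrightarrow> finite c \<Longrightarrow> finite d \<Longrightarrow> card c = b \<Longrightarrow> card d = b \<Longrightarrow>
           b \<le> card (L v - (c \<union> d))"
        using ex_small_sets_forcing_overlap[of "L v" a "L' (v + (-1, 0))" b "L' (v + (1, -1))"]
          L'_card L'_fin True ab by metis
      then show ?thesis by blast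
    next
      case False
      then show ?thesis by (intro exI[of _ "{}"]) auto
    qed
    then obtain X Y where XY: "\<And>v. card (X v) \<le> b div 2" "\<And>v. card (Y v) \<le> b div 2"
      "\<And>v. v + (-1, 0) \<in> W \<Longrightarrow> X v \<subseteq> L' (v + (-1, 0))"
      "\<And>v. v + (1, -1) \<in> W \<Longrightarrow> Y v \<subseteq> L' (v + (1, -1))"
      "\<And>v c d. \<lbrakk>v \<in> T; v + (-1, 0) \<in> W; v + (1, -1) \<in> W; X v \<subseteq> c; Y v \<subseteq> d;
         finite c; finite d; card c = b; card d = b\<rbrakk> \<Longrightarrow> b \<le> card (L v - (c \<union> d))"
      by metis

    \<comment> \<open>Exactly \<open>w + (1, 0)\<close> and \<open>w + (-1, 1)\<close> can have
      \<open>w\<close> as a neighbour one level down. Their prescriptions total at most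
      \<open>2 * (b div 2) \<le> b\<close> colours.\<close>
    have "\<exists>c. X (w + (1, 0)) \<union> Y (w + (-1, 1)) \<subseteq> c \<and> c \<subseteq> L' w \<and> card c = b" if w: "w \<in> W" for w
    proof -
      have "X (w + (1, 0)) \<union> Y (w + (-1, 1)) \<subseteq> L' w"
        using XY(3)[of "w + (1, 0)"] XY(4)[of "w + (-1, 1)"] w
        by (simp add: add.assoc flip: zero_prod_def)
      moreover have "card (X (w + (1, 0)) \<union> Y (w + (-1, 1))) \<le> b"
        using card_Un_le[of "X (w + (1, 0))" "Y (w + (-1, 1))"]
          XY(1)[of "w + (1, 0)"] XY(2)[of "w + (-1, 1)"] by linarith
      moreover have "b \<le> card (L' w)" using L'_card[OF w] ab by linarith
      ultimately show ?thesis using L'_fin[OF w] exists_subset_between by metis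
    qed
    then obtain cW where cW: "\<And>w. w \<in> W \<Longrightarrow> X (w + (1, 0)) \<union> Y (w + (-1, 1)) \<subseteq> cW w"
      "\<And>w. w \<in> W \<Longrightarrow> cW w \<subseteq> L' w" "\<And>w. w \<in> W \<Longrightarrow> card (cW w) = b"
      by metis
    have fin_cW: "finite (cW w)" if "w \<in> W" for w
      using cW(2)[OF that] L'_fin[OF that] by (rule finite_subset)

    define g where "g u = (if u \<in> W then cW u else c0 u)" for u
    define Nb where "Nb v = {u \<in> V. adjacent v u}" for v
    have Nb_disj: "Nb v \<inter> T = {}" if "v \<in> T" for v
      using that level_adjacent_neq by (fastforce simp: Nb_def T_def)
    have g: "card (g u) = b" "finite (g u)" if "u \<in> V" "u \<notin> T" for u
      using that c0 fin_c0 cW fin_cW by (auto simp: g_def V'_def)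
    have "b \<le> card (L v - (\<Union>u\<in>Nb v. g u))" if v: "v \<in> T" for v
    proof -
      have vV: "v \<in> V" "level v = M" using v by (auto simp: T_def)
      have Nb_sub: "Nb v \<subseteq> {v + (-1, 0), v + (1, -1), v + (0, -1)}"
      proof
        fix u assume "u \<in> Nb v"
        then have "adjacent v u" "level u \<le> level v" using le_M vV(2) by (auto simp: Nb_def)
        then show "u \<in> {v + (-1, 0), v + (1, -1), v + (0, -1)}"
          by (rule adjacent_not_above) auto
      qed
      have adj: "adjacent (v + (-1, 0)) (v + (0, -1))" "adjacent (v + (0, -1)) (v + (1, -1))"
        by (auto simp: adjacent_iff)
      \<comment> \<open>A neighbour two levels down excludes all others, so \<open>v\<close> has two
        neighbours only when both lie in \<open>W\<close>.\<close>
      have sub: False if "v + (0, -1) \<in> Nb v" "v + (-1, 0) \<in> Nb v \<or> v + (1, -1) \<in> Nb v"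
        using that adj vV(1) adjacent_sym
          tri[of v "v + (-1, 0)" "v + (0, -1)"] tri[of v "v + (0, -1)" "v + (1, -1)"]
        unfolding Nb_def mem_Collect_eq by blast
      have in_W: "u \<in> W" if "u \<in> Nb v" "u = v + (-1, 0) \<or> u = v + (1, -1)" for u
        using that v vV by (auto simp: Nb_def W_def level_def)
      show ?thesis
      proof (cases "v + (-1, 0) \<in> Nb v \<and> v + (1, -1) \<in> Nb v")
        case True
        then have "Nb v = {v + (-1, 0), v + (1, -1)}" using Nb_sub sub by blast
        moreover have W: "v + (-1, 0) \<in> W" "v + (1, -1) \<in> W" using True in_W by blast+
        moreover have "X v \<subseteq> cW (v + (-1, 0))" "Y v \<subseteq> cW (v + (1, -1))"
          using cW(1)[OF W(1)] cW(1)[OF W(2)] by (simp_all add: add.assoc flip: zero_prod_def)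
        ultimately show ?thesis
          using XY(5)[OF v W] fin_cW cW(3) by (simp add: g_def)
      next
        case False
        then obtain x where "Nb v \<subseteq> {x}" using Nb_sub sub by blast
        moreover have "card (g u) = b" "finite (g u)" if "u \<in> Nb v" for u
          using g[of u] that Nb_disj[OF v] unfolding Nb_def by blast+
        ultimately have "a - b \<le> card (L v - (\<Union>u\<in>Nb v. g u))"
          using L[OF vV(1)] by (intro card_Diff_UN_subsingleton) auto
        then show ?thesis using ab by linarith
      qed
    qed
    then have "\<exists>c \<subseteq> L v - (\<Union>u\<in>Nb v. g u). card c = b" if "v \<in> T" for v
      using that by (meson obtain_subset_with_card_n)
    then obtain cT where cT: "\<And>v. v \<in> T \<Longrightarrow> cT v \<subseteq> L v - (\<Union>u\<in>Nb v. g u)"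
      "\<And>v. v \<in> T \<Longrightarrow> card (cT v) = b"
      by metis

    define c where "c v = (if v \<in> T then cT v else g v)" for v
    have "c v \<subseteq> L v \<and> card (c v) = b" if "v \<in> V" for v
      using that cT[of v] cW(2,3)[of v] c0[of v] by (auto simp: c_def g_def L'_def V'_def)
    \<comment> \<open>Edges are checked by the parts containing their ends; no edge joins two
      vertices of \<open>T\<close> or two of \<open>W\<close>, as these have equal level.\<close>
    moreover have TW: "c v \<inter> c w = {}" if "v \<in> T" "w \<in> V" "adjacent v w" for v w
      using that cT(1)[of v] Nb_disj[of v] by (auto simp: c_def Nb_def)
    moreover have "c v \<inter> c w = {}" if "v \<in> W" "w \<in> V'" "adjacent v w" for v w
      using that cW(2)[of v] by (auto simp: c_def g_def L'_def N_def V'_def T_def W_def)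
    moreover have "\<not> adjacent v w" if "v \<in> W" "w \<in> W" for v w
      using that level_adjacent_neq by (fastforce simp: W_def)
    moreover have "c v \<inter> c w = {}" if "v \<in> V'" "w \<in> V'" "adjacent v w" for v w
      using that c0_disj by (auto simp: c_def g_def V'_def)
    moreover have "V = T \<union> W \<union> V'" by (auto simp: V'_def T_def W_def)
    ultimately have "(\<forall>v\<in>V. c v \<subseteq> L v \<and> card (c v) = b) \<and>
        (\<forall>v\<in>V. \<forall>w\<in>V. adjacent v w \<longrightarrow> c v \<inter> c w = {})"
      using adjacent_sym by (metis Int_commute Un_iff)
    then show ?thesis by blast
  qed simp
qed

theorem theorem4p4:
  fixes R :: "(int \<times> int) pair_pre_digraph"
  assumes "finite (pverts R)"
    and "induced_subgraph (with_proj R) (with_proj triangular_lattice)"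
    and "triangle_free (with_proj R)"
  shows "(\<forall>a b :: nat. a > 0 \<and> b > 0 \<and> real a / real b \<ge> 5 / 2 \<longrightarrow> choosable (with_proj R) a b) \<and>
         choosable (with_proj R) 5 2"
proof -
  have arcs: "parcs R = parcs triangular_lattice \<inter> (pverts R \<times> pverts R)"
    using assms(2) by (simp add: induced_subgraph_triangular_lattice_iff)
  have tri: "\<not> adjacent w u"
    if "u \<in> pverts R" "v \<in> pverts R" "w \<in> pverts R" "adjacent u v" "adjacent v w" for u v w
  proof
    assume "adjacent w u"
    then have "distinct [u, v, w]" "(u, v) \<in> parcs R" "(v, w) \<in> parcs R" "(w, u) \<in> parcs R"
      using that level_adjacent_neq[of u v] level_adjacent_neq[of v w] level_adjacent_neq[of w u] arcs
      by auto
    then show False using assms(3) unfolding triangle_free_def with_proj_simps by blast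
  qed
  \<comment> \<open>The ratio condition in integers; \<open>(5, 2)\<close> attains equality, so both
    claims are instances.\<close>
  have choosable: "choosable (with_proj R) a b" if "5 * b \<le> 2 * a" for a b
    unfolding choosable_def with_proj_simps
  proof (intro allI impI)
    fix L :: "int \<times> int \<Rightarrow> nat set"
    assume "\<forall>v\<in>pverts R. finite (L v) \<and> card (L v) = a"
    then have "\<exists>c. (\<forall>v\<in>pverts R. c v \<subseteq> L v \<and> card (c v) = b) \<and>
        (\<forall>v\<in>pverts R. \<forall>w\<in>pverts R. adjacent v w \<longrightarrow> c v \<inter> c w = {})"
      by (intro triangle_free_set_choosable[OF assms(1) _ that] tri) auto
    then show "\<exists>c. (\<forall>v\<in>pverts R. c v \<subseteq> L v \<and> card (c v) = b) \<and>
        (\<forall>v v'. (v, v') \<in> parcs R \<longrightarrow> c v \<inter> c v' = {})"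
      unfolding arcs by blast
  qed
  have "5 * b \<le> 2 * a" if "b > 0" "real a / real b \<ge> 5 / 2" for a b :: nat
  proof -
    have "5 * real b \<le> 2 * real a" using that by (simp add: field_simps)
    then show ?thesis by linarith
  qed
  then show ?thesis using choosable by simp
qed

end
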